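(* Let $E$ be a Banach lattice with order continuous norm and a weak unit $e \in E_+$. Let $T$ be a positive, power-bounded, mean ergodic operator on $E$ with mean ergodic projection $P$, and let $A_n := \frac{1}{n}\sum_{k=0}^{n-1} T^k$ for $n \in \mathbb{N}$. Suppose that: (i) $Te \le e$; (ii) for each $x \in E$ the sequence $(A_n |x|)_{n \in \mathbb{N}}$ is order bounded in the universal completion $E^u$ of $E$. Then, for each $x \in E$, the sequence $(A_n x)_{n \in \mathbb{N}}$ is order convergent to $Px$ in $E^u$ and, in particular, $(A_n x)_{n\in\mathbb{N}}$ is uo-convergent to $Px$ in $E$.
   Context: The norm of a Banach lattice is order continuous if $x_\alpha \downarrow 0$ implies $\|x_\alpha\| \to 0$ for each decreasing net. An element $e \in E_+$ is a weak unit if $x \wedge e = 0$ implies $x = 0$ for each $x \in E_+$. A bounded operator $T$ is power-bounded if $\sup_n \|T^n\| < \infty$, and mean ergodic if the Cesàro means $A_n$ converge strongly; the strong limit $P$ is then a projection, called the mean ergodic projection. The universal completion $E^u$ of an Archimedean vector lattice $E$ is the (unique up to lattice isomorphism) universally complete vector lattice (i.e. Dedekind complete, and every non-empty pairwise disjoint family of positive elements has a supremum) containing $E$ as an order dense sublattice (for each $0 < x \in E^u$ there is $y \in E$ with $0 < y \le x$). A sequence $(x_n)$ in a vector lattice $F$ is order convergent to $x$ if there is a sequence $y_n \downarrow 0$ in $F$ with $|x_n - x| \le y_n$ for all $n$; it is uo-convergent to $x$ if $|x_n - x| \wedge u$ is order convergent to $0$ in $F$ for each $u \in F_+$. *)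

theory Defs
  imports "HOL-Analysis.Analysis" "HOL-Library.Lattice_Algebras"
begin

class vector_lattice = ordered_real_vector + lattice_ab_group_add_abs

class banach_lattice = banach + vector_lattice +
  assumes lattice_norm: "\<bar>x\<bar> \<le> \<bar>y\<bar> \<Longrightarrow> norm x \<le> norm y"

definition directed_on :: "'i set \<Rightarrow> ('i \<Rightarrow> 'i \<Rightarrow> bool) \<Rightarrow> bool" where
  "directed_on I R \<longleftrightarrow> I \<noteq> {} \<and> (\<forall>i\<in>I. R i i) \<and>
     (\<forall>i\<in>I. \<forall>j\<in>I. \<forall>k\<in>I. R i j \<longrightarrow> R j k \<longrightarrow> R i k) \<and>
     (\<forall>i\<in>I. \<forall>j\<in>I. \<exists>k\<in>I. R i k \<and> R j k)"

definition net_decreases_to ::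
    "'i set \<Rightarrow> ('i \<Rightarrow> 'i \<Rightarrow> bool) \<Rightarrow> ('i \<Rightarrow> 'a::order) \<Rightarrow> 'a \<Rightarrow> bool" where
  "net_decreases_to I R x a \<longleftrightarrow>
     (\<forall>i\<in>I. \<forall>j\<in>I. R i j \<longrightarrow> x j \<le> x i) \<and>
     (\<forall>i\<in>I. a \<le> x i) \<and> (\<forall>z. (\<forall>i\<in>I. z \<le> x i) \<longrightarrow> z \<le> a)"

definition net_tendsto ::
    "'i set \<Rightarrow> ('i \<Rightarrow> 'i \<Rightarrow> bool) \<Rightarrow> ('i \<Rightarrow> real) \<Rightarrow> real \<Rightarrow> bool" where
  "net_tendsto I R r l \<longleftrightarrow> (\<forall>\<epsilon>>0. \<exists>i\<in>I. \<forall>j\<in>I. R i j \<longrightarrow> \<bar>r j - l\<bar> < \<epsilon>)"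

text \<open>A definition cannot quantify over types, so the index sets range over the subsets of the space
  itself. The lemma below shows that this covers nets with arbitrary index types.\<close>

definition order_continuous_norm :: "'a::banach_lattice itself \<Rightarrow> bool" where
  "order_continuous_norm TYPE('a) \<longleftrightarrow>
     (\<forall>(I::'a set) R (x::'a \<Rightarrow> 'a). directed_on I R \<longrightarrow> net_decreases_to I R x 0 \<longrightarrow>
        net_tendsto I R (\<lambda>i. norm (x i)) 0)"

lemma order_continuous_norm_net:
  fixes x :: "'i \<Rightarrow> 'a::banach_lattice"
  assumes oc: "order_continuous_norm TYPE('a)"
    and dir: "directed_on I R" and dec: "net_decreases_to I R x 0"
  shows "net_tendsto I R (\<lambda>i. norm (x i)) 0"
proof -
  let ?D = "x ` I" and ?S = "\<lambda>a b::'a. b \<le> a"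
  have "directed_on ?D ?S"
    unfolding directed_on_def
  proof (intro conjI ballI impI)
    show "?D \<noteq> {}"
      using dir by (auto simp: directed_on_def)
    fix a b assume "a \<in> ?D" "b \<in> ?D"
    then obtain i j where ij: "i \<in> I" "j \<in> I" "a = x i" "b = x j" by auto
    with dir obtain k where "k \<in> I" "R i k" "R j k"
      unfolding directed_on_def by metis
    with ij dec show "\<exists>c\<in>?D. c \<le> a \<and> c \<le> b"
      unfolding net_decreases_to_def by blast
  qed auto
  moreover have "net_decreases_to ?D ?S id 0"
    using dec unfolding net_decreases_to_def by auto
  ultimately have tend: "net_tendsto ?D ?S (\<lambda>a. norm (id a)) 0"
    using oc unfolding order_continuous_norm_def by blast
  show ?thesis
    unfolding net_tendsto_def
  proof (intro allI impI)
    fix \<epsilon> :: real assume "\<epsilon> > 0"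
    with tend obtain i where "i \<in> I" "\<forall>j\<in>I. x j \<le> x i \<longrightarrow> \<bar>norm (x j) - 0\<bar> < \<epsilon>"
      unfolding net_tendsto_def by auto
    with dec show "\<exists>i\<in>I. \<forall>j\<in>I. R i j \<longrightarrow> \<bar>norm (x j) - 0\<bar> < \<epsilon>"
      unfolding net_decreases_to_def by blast
  qed
qed

definition weak_unit :: "'a::vector_lattice \<Rightarrow> bool" where
  "weak_unit e \<longleftrightarrow> 0 \<le> e \<and> (\<forall>x\<ge>0. inf x e = 0 \<longrightarrow> x = 0)"

definition positive_operator :: "('a::vector_lattice \<Rightarrow> 'a) \<Rightarrow> bool" where
  "positive_operator T \<longleftrightarrow> (\<forall>x\<ge>0. 0 \<le> T x)"

definition power_bounded :: "('a::real_normed_vector \<Rightarrow> 'a) \<Rightarrow> bool" where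
  "power_bounded T \<longleftrightarrow> bdd_above (range (\<lambda>n. onorm (T ^^ n)))"

text \<open>The Cesaro means are meaningful for \<open>n \<ge> 1\<close>; sequences of them are therefore
  written \<open>\<lambda>n. cesaro T (Suc n) x\<close>.\<close>

definition cesaro :: "('a::real_vector \<Rightarrow> 'a) \<Rightarrow> nat \<Rightarrow> 'a \<Rightarrow> 'a" where
  "cesaro T n x = (1 / real n) *\<^sub>R (\<Sum>k<n. (T ^^ k) x)"

definition mean_ergodic :: "('a::real_normed_vector \<Rightarrow> 'a) \<Rightarrow> bool" where
  "mean_ergodic T \<longleftrightarrow> (\<forall>x. convergent (\<lambda>n. cesaro T (Suc n) x))"

definition mean_ergodic_projection :: "('a::real_normed_vector \<Rightarrow> 'a) \<Rightarrow> 'a \<Rightarrow> 'a" where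
  "mean_ergodic_projection T x = lim (\<lambda>n. cesaro T (Suc n) x)"

text \<open>Dedekind completeness is provided by \<^class>\<open>conditionally_complete_lattice\<close>.\<close>

class universally_complete_vector_lattice = vector_lattice + conditionally_complete_lattice +
  assumes disjoint_sup: "S \<noteq> {} \<Longrightarrow> (\<forall>x\<in>S. 0 \<le> x) \<Longrightarrow> pairwise (\<lambda>x y. inf x y = 0) S \<Longrightarrow>
    \<exists>s. (\<forall>x\<in>S. x \<le> s) \<and> (\<forall>z. (\<forall>x\<in>S. x \<le> z) \<longrightarrow> s \<le> z)"

text \<open>The type \<open>'u\<close> is a universal completion of \<open>'a\<close>, with \<open>J\<close> as the inclusion map.\<close>

definition universal_completion ::
    "('a::vector_lattice \<Rightarrow> 'u::universally_complete_vector_lattice) \<Rightarrow> bool" where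
  "universal_completion J \<longleftrightarrow> linear J \<and> inj J \<and>
     (\<forall>x y. J (sup x y) = sup (J x) (J y)) \<and> (\<forall>x y. J (inf x y) = inf (J x) (J y)) \<and>
     (\<forall>u>0. \<exists>y. 0 < J y \<and> J y \<le> u)"

definition order_bounded :: "'a::order set \<Rightarrow> bool" where
  "order_bounded S \<longleftrightarrow> (\<exists>a b. S \<subseteq> {a..b})"

definition seq_decreases_to :: "(nat \<Rightarrow> 'a::order) \<Rightarrow> 'a \<Rightarrow> bool" where
  "seq_decreases_to y a \<longleftrightarrow>
     decseq y \<and> (\<forall>n. a \<le> y n) \<and> (\<forall>z. (\<forall>n. z \<le> y n) \<longrightarrow> z \<le> a)"

definition order_convergent :: "(nat \<Rightarrow> 'a::vector_lattice) \<Rightarrow> 'a \<Rightarrow> bool" where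
  "order_convergent x l \<longleftrightarrow> (\<exists>y. seq_decreases_to y 0 \<and> (\<forall>n. \<bar>x n - l\<bar> \<le> y n))"

definition uo_convergent :: "(nat \<Rightarrow> 'a::vector_lattice) \<Rightarrow> 'a \<Rightarrow> bool" where
  "uo_convergent x l \<longleftrightarrow> (\<forall>u\<ge>0. order_convergent (\<lambda>n. inf \<bar>x n - l\<bar> u) 0)"

end

theory Submission
  imports Defs
begin

text \<open>Since \<open>x - P x\<close> lies in the closure of the range of \<open>I - T\<close> and the ideal generated by \<open>e\<close> is
  norm dense, \<open>x - P x = (y\<^sub>k - T y\<^sub>k) + z\<^sub>k\<close> with \<open>\<bar>y\<^sub>k\<bar> \<le> c\<^sub>k e\<close> and \<open>\<parallel>z\<^sub>k\<parallel> < 4\<^sup>-\<^sup>k\<close>. The first summand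
  telescopes under the Cesaro means and \<open>T e \<le> e\<close> bounds the result by \<open>(2 c\<^sub>k / n) e\<close>. No maximal
  inequality is needed for the second one: with \<open>w = \<Sum>k. 2\<^sup>k \<bar>z\<^sub>k\<bar>\<close> we have \<open>\<bar>z\<^sub>k\<bar> \<le> 2\<^sup>-\<^sup>k w\<close>, so
  an upper bound \<open>b\<close> of the sequence \<open>A\<^sub>n w\<close> in the universal completion gives \<open>\<bar>A\<^sub>n z\<^sub>k\<bar> \<le> 2\<^sup>-\<^sup>k b\<close> for
  all \<open>n\<close>, and the universal completion is Archimedean. Order convergence there passes to
  uo-convergence in \<open>E\<close> because an order dense sublattice is regular and order continuity of the
  norm yields countable suprema in \<open>E\<close>.\<close>

section \<open>Closedness of the positive cone and the Archimedean property\<close>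

text \<open>If \<open>0 \<le> f n\<close>, the negative part of \<open>l\<close> lies below
  \<open>\<bar>f n - l\<bar>\<close>, so its norm is at most \<open>norm (f n - l)\<close>, which
  tends to 0.\<close>

lemma closed_cone:
  fixes f :: "nat \<Rightarrow> 'a::banach_lattice"
  assumes "f \<longlonglongrightarrow> l" "\<forall>\<^sub>F n in sequentially. 0 \<le> f n"
  shows "0 \<le> l"
proof -
  have "norm (sup (- l) 0) \<le> norm (f n - l)" if "0 \<le> f n" for n
  proof (rule lattice_norm)
    have "- l \<le> f n - l" using that by simp
    also have "\<dots> \<le> \<bar>f n - l\<bar>" by (rule abs_ge_self)
    finally have "sup (- l) 0 \<le> \<bar>f n - l\<bar>" by simp
    then show "\<bar>sup (- l) 0\<bar> \<le> \<bar>f n - l\<bar>" by simp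
  qed
  then have "\<forall>\<^sub>F n in sequentially. norm (sup (- l) 0) \<le> norm (f n - l)"
    using assms(2) by (auto elim: eventually_mono)
  moreover have "(\<lambda>n. norm (f n - l)) \<longlonglongrightarrow> 0"
    using assms(1) by (simp add: LIM_zero tendsto_norm_zero)
  ultimately have "norm (sup (- l) 0) \<le> 0"
    by (intro tendsto_lowerbound[of "\<lambda>n. norm (f n - l)"]) auto
  then have "sup (- l) 0 = 0" by simp
  then have "- l \<le> 0" by (metis sup.cobounded1)
  then show ?thesis by simp
qed

lemma limit_mono:
  fixes f g :: "nat \<Rightarrow> 'a::banach_lattice"
  assumes "f \<longlonglongrightarrow> a" "g \<longlonglongrightarrow> b" "\<forall>\<^sub>F n in sequentially. f n \<le> g n"
  shows "a \<le> b"
  using closed_cone[OF tendsto_diff[OF assms(2,1)]] assms(3) by simp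

lemma archimedean_banach_lattice:
  fixes z x :: "'a::banach_lattice"
  assumes "\<And>n::nat. real n *\<^sub>R z \<le> x"
  shows "z \<le> 0"
proof (rule limit_mono)
  show "(\<lambda>n. z) \<longlonglongrightarrow> z" by simp
  show "(\<lambda>n. (1 / real (Suc n)) *\<^sub>R x) \<longlonglongrightarrow> 0"
    using tendsto_scaleR[OF LIMSEQ_Suc[OF lim_1_over_n] tendsto_const[of x]] by simp
  show "\<forall>\<^sub>F n in sequentially. z \<le> (1 / real (Suc n)) *\<^sub>R x"
  proof (rule always_eventually, rule allI)
    fix n
    show "z \<le> (1 / real (Suc n)) *\<^sub>R x"
      using scaleR_left_mono[OF assms[of "Suc n"], of "1 / real (Suc n)"] by simp
  qed
qed

text \<open>Dedekind completeness replaces the norm argument: adding \<open>z\<close> to a multiple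
  of \<open>z\<close> gives the next multiple, so \<open>Sup ?S - z\<close> is still an upper bound
  of \<open>?S\<close>.\<close>

lemma archimedean_complete:
  fixes z x :: "'u::universally_complete_vector_lattice"
  assumes "\<And>n::nat. real n *\<^sub>R z \<le> x"
  shows "z \<le> 0"
proof -
  let ?S = "range (\<lambda>n::nat. real n *\<^sub>R z)"
  have bdd: "bdd_above ?S" by (rule bdd_aboveI[where M = x]) (use assms in blast)
  have "Sup ?S \<le> Sup ?S - z"
  proof (rule cSup_least)
    fix t assume "t \<in> ?S"
    then obtain n :: nat where t: "t = real n *\<^sub>R z" by auto
    have "real (Suc n) *\<^sub>R z \<le> Sup ?S" by (rule cSup_upper[OF _ bdd]) blast
    then show "t \<le> Sup ?S - z" by (simp add: t scaleR_add_left le_diff_eq add.commute)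
  qed simp
  then show ?thesis by simp
qed

text \<open>For each \<open>n\<close> some \<open>k\<close> has \<open>real n * a k \<le> 1\<close>,
  which bounds \<open>real n *\<^sub>R z\<close> by \<open>x\<close>. The limits
  \<open>n \<rightarrow> \<infinity>\<close> and \<open>k \<rightarrow> \<infinity>\<close> in the
  final estimate are both taken this way.\<close>

lemma archimedean_complete_vanishing:
  fixes z x :: "'u::universally_complete_vector_lattice"
  assumes "\<And>n. z \<le> a n *\<^sub>R x" "a \<longlonglongrightarrow> 0" "\<And>n. 0 < a n" "0 \<le> x"
  shows "z \<le> 0"
proof (rule archimedean_complete)
  fix n :: nat
  have "\<forall>\<^sub>F k in sequentially. a k < 1 / (real n + 1)"
    using order_tendstoD(2)[OF assms(2), of "1 / (real n + 1)"] by simp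
  then obtain k where "a k < 1 / (real n + 1)"
    using eventually_happens by force
  then have "a k * (real n + 1) < 1"
    by (simp add: less_divide_eq)
  then have "real n * a k \<le> 1"
    using assms(3)[of k] by (simp add: algebra_simps)
  then have "(real n * a k) *\<^sub>R x \<le> 1 *\<^sub>R x"
    by (rule scaleR_right_mono[OF _ assms(4)])
  moreover have "real n *\<^sub>R z \<le> real n *\<^sub>R (a k *\<^sub>R x)"
    by (rule scaleR_left_mono[OF assms(1)]) simp
  ultimately show "real n *\<^sub>R z \<le> x" by simp
qed

section \<open>Consequences of order continuity of the norm\<close>

lemma directed_on_nat: "directed_on UNIV ((\<le>) :: nat \<Rightarrow> nat \<Rightarrow> bool)"
  unfolding directed_on_def by (auto intro: max.cobounded1 max.cobounded2)

lemma order_continuous_norm_seq: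
  fixes f :: "nat \<Rightarrow> 'a::banach_lattice"
  assumes "order_continuous_norm TYPE('a)" "seq_decreases_to f 0"
  shows "f \<longlonglongrightarrow> 0"
proof -
  have "net_decreases_to UNIV (\<le>) f 0"
    using assms(2) unfolding net_decreases_to_def seq_decreases_to_def decseq_def by auto
  from order_continuous_norm_net[OF assms(1) directed_on_nat this]
  show ?thesis
    unfolding net_tendsto_def LIMSEQ_iff by simp
qed

text \<open>A supremum of \<open>p\<close> is not yet known to exist, so it cannot be used to form a
  sequence decreasing to 0; all upper bounds of \<open>p\<close> together take its place.\<close>

lemma order_continuous_norm_incseq_Cauchy:
  fixes p :: "nat \<Rightarrow> 'a::banach_lattice"
  assumes oc: "order_continuous_norm TYPE('a)" and inc: "incseq p" and u: "\<And>n. p n \<le> u"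
  shows "Cauchy p"
proof -
  \<comment> \<open>The differences of upper bounds and terms of \<open>p\<close> form a net decreasing to 0.\<close>
  define B where "B = {b. \<forall>n. p n \<le> b}"
  define I where "I = B \<times> (UNIV :: nat set)"
  define R where "R i j \<longleftrightarrow> fst j \<le> fst i \<and> snd i \<le> snd j" for i j :: "'a \<times> nat"
  define f where "f i = fst i - p (snd i)" for i :: "'a \<times> nat"
  have "directed_on I R"
    unfolding directed_on_def
  proof (intro conjI ballI impI)
    show "I \<noteq> {}" using u by (auto simp: I_def B_def)
    fix i j assume "i \<in> I" "j \<in> I"
    then have "(inf (fst i) (fst j), max (snd i) (snd j)) \<in> I"
      by (auto simp: I_def B_def)
    then show "\<exists>k\<in>I. R i k \<and> R j k"
      by (rule bexI[rotated]) (simp add: R_def)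
  qed (auto simp: R_def)
  moreover have "net_decreases_to I R f 0"
    unfolding net_decreases_to_def
  proof (intro conjI ballI allI impI)
    fix i j assume "R i j"
    then show "f j \<le> f i"
      unfolding f_def R_def by (intro diff_mono) (auto intro: incseqD[OF inc])
  next
    fix i assume "i \<in> I"
    then show "0 \<le> f i" by (auto simp: f_def I_def B_def)
  next
    fix z assume z: "\<forall>i\<in>I. z \<le> f i"
    \<comment> \<open>A lower bound \<open>z\<close> of all differences can be subtracted from an
      upper bound of \<open>p\<close> without leaving \<open>B\<close>. Repeating this from
      \<open>u\<close> bounds every multiple of \<open>z\<close> by \<open>u - p 0\<close>, and the
      Archimedean property applies.\<close>
    have step: "b - z \<in> B" if "b \<in> B" for b
      unfolding B_def
    proof safe
      fix n
      have "z \<le> b - p n" using z that by (force simp: f_def I_def)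
      then show "p n \<le> b - z" by (simp add: algebra_simps)
    qed
    have "u - real n *\<^sub>R z \<in> B" for n
    proof (induction n)
      case 0
      then show ?case using u by (simp add: B_def)
    next
      case (Suc n)
      from step[OF this] show ?case by (simp add: algebra_simps)
    qed
    then have "p 0 \<le> u - real n *\<^sub>R z" for n
      unfolding B_def by blast
    then have "real n *\<^sub>R z \<le> u - p 0" for n
      by (metis le_diff_eq add.commute)
    then show "z \<le> 0" by (rule archimedean_banach_lattice)
  qed
  ultimately have tend: "net_tendsto I R (\<lambda>i. norm (f i)) 0"
    by (rule order_continuous_norm_net[OF oc])
  show ?thesis
  proof (rule CauchyI')
    fix \<epsilon> :: real assume "0 < \<epsilon>"
    with tend obtain b m where bm: "(b, m) \<in> I"
      "\<And>j. j \<in> I \<Longrightarrow> R (b, m) j \<Longrightarrow> norm (f j) < \<epsilon>"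
      unfolding net_tendsto_def by force
    have "dist (p k) (p n) < \<epsilon>" if "m \<le> k" "k < n" for k n
    proof -
      have 1: "p k \<le> p n" using that by (intro incseqD[OF inc]) simp
      have 2: "p n \<le> b" using bm(1) by (simp add: I_def B_def)
      have "norm (p n - p k) \<le> norm (b - p k)"
        using 1 2 order_trans[OF 1 2] by (intro lattice_norm) simp
      also have "\<dots> < \<epsilon>"
        using bm(2)[of "(b, k)"] bm(1) that by (simp add: f_def R_def I_def)
      finally show ?thesis by (simp add: dist_norm norm_minus_commute)
    qed
    then show "\<exists>M. \<forall>m\<ge>M. \<forall>n>m. dist (p m) (p n) < \<epsilon>" by blast
  qed
qed

text \<open>The finite suprema \<open>p n\<close> increase and are bounded, hence converge in norm;
  since the cone is closed, their limit is the least upper bound.\<close>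

lemma order_continuous_norm_countable_sup:
  fixes d :: "nat \<Rightarrow> 'a::banach_lattice"
  assumes oc: "order_continuous_norm TYPE('a)" and u: "\<And>n. d n \<le> u"
  shows "\<exists>s. (\<forall>n. d n \<le> s) \<and> (\<forall>z. (\<forall>n. d n \<le> z) \<longrightarrow> s \<le> z)"
proof -
  define p where "p n = Sup_fin (d ` {..n})" for n
  have inc: "incseq p"
    unfolding p_def by (intro incseq_SucI Sup_fin.subset_imp) auto
  have bound: "p n \<le> z" if "\<forall>n. d n \<le> z" for n z
    unfolding p_def using that by (intro Sup_fin.boundedI) auto
  have "Cauchy p"
    by (rule order_continuous_norm_incseq_Cauchy[OF oc inc bound]) (use u in blast)
  then obtain s where s: "p \<longlonglongrightarrow> s"
    using Cauchy_convergent convergent_def by blast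
  show ?thesis
  proof (intro exI conjI allI impI)
    fix n
    have "d n \<le> p m" if "n \<le> m" for m
      unfolding p_def using that by (intro Sup_fin.coboundedI) auto
    then show "d n \<le> s"
      by (intro limit_mono[OF tendsto_const s]) (auto simp: eventually_sequentially)
  next
    fix z assume "\<forall>n. d n \<le> z"
    then show "s \<le> z"
      by (intro limit_mono[OF s tendsto_const] always_eventually) (auto intro: bound)
  qed
qed

section \<open>Density of the ideal generated by a weak unit\<close>

lemma tendsto_inf_weak_unit:
  fixes x :: "'a::banach_lattice"
  assumes oc: "order_continuous_norm TYPE('a)" and e: "weak_unit e" and x: "0 \<le> x"
  shows "(\<lambda>n. inf x (real n *\<^sub>R e)) \<longlonglongrightarrow> x"
proof -
  have e0: "0 \<le> e" using e by (simp add: weak_unit_def)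
  have "seq_decreases_to (\<lambda>n. x - inf x (real n *\<^sub>R e)) 0"
    unfolding seq_decreases_to_def
  proof (intro conjI allI impI)
    show "decseq (\<lambda>n. x - inf x (real n *\<^sub>R e))"
      using e0 by (intro decseq_SucI diff_left_mono inf_mono scaleR_right_mono) auto
    show "0 \<le> x - inf x (real n *\<^sub>R e)" for n by (simp only: diff_ge_0_iff_ge inf.cobounded1)
    fix z assume z: "\<forall>n. z \<le> x - inf x (real n *\<^sub>R e)"
    \<comment> \<open>The goal is \<open>w = 0\<close>, which yields \<open>sup z 0 = 0\<close>
      because \<open>e\<close> is a weak unit. From \<open>real n *\<^sub>R w \<le> x\<close> and
      \<open>w \<le> e\<close> follows
      \<open>real n *\<^sub>R w \<le> inf x (real n *\<^sub>R e)\<close>; as \<open>w\<close> also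
      lies below the remainder, one more copy of \<open>w\<close> still fits under
      \<open>x\<close>.\<close>
    define w where "w = inf (sup z 0) e"
    have w: "w \<le> x - inf x (real n *\<^sub>R e)" for n
    proof -
      have "sup z 0 \<le> x - inf x (real n *\<^sub>R e)"
        using z by (intro le_supI) (blast, simp only: diff_ge_0_iff_ge inf.cobounded1)
      then show ?thesis unfolding w_def by (rule le_infI1)
    qed
    have we: "w \<le> e" by (simp add: w_def)
    have "real n *\<^sub>R w \<le> x" for n
    proof (induction n)
      case 0
      then show ?case using x by simp
    next
      case (Suc n)
      have "real n *\<^sub>R w \<le> inf x (real n *\<^sub>R e)"
        using Suc scaleR_left_mono[OF we] by simp
      with w[of n] have "w + real n *\<^sub>R w \<le> x - inf x (real n *\<^sub>R e) + inf x (real n *\<^sub>R e)"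
        by (rule add_mono)
      then have "w + real n *\<^sub>R w \<le> x" by (simp only: diff_add_cancel)
      then show ?case by (simp add: scaleR_add_left)
    qed
    then have "w \<le> 0" by (rule archimedean_banach_lattice)
    moreover have "0 \<le> w" using e0 by (simp add: w_def)
    ultimately have "inf (sup z 0) e = 0" unfolding w_def by (rule order_antisym)
    then have "sup z 0 = 0" using e by (simp add: weak_unit_def)
    then show "z \<le> 0" by (metis sup.cobounded1)
  qed
  from tendsto_diff[OF tendsto_const[of x] order_continuous_norm_seq[OF oc this]]
  show ?thesis by simp
qed

text \<open>Positive and negative part are truncated separately. Both truncations lie between 0 and
  \<open>real n *\<^sub>R e\<close>, hence so does the modulus of their difference.\<close>

lemma weak_unit_ideal_dense:
  fixes x :: "'a::banach_lattice"
  assumes "order_continuous_norm TYPE('a)" "weak_unit e"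
  obtains y where "y \<longlonglongrightarrow> x" "\<And>n. \<bar>y n\<bar> \<le> real n *\<^sub>R e"
proof
  let ?a = "\<lambda>n. inf (sup x 0) (real n *\<^sub>R e)" and ?b = "\<lambda>n. inf (sup (- x) 0) (real n *\<^sub>R e)"
  have e0: "0 \<le> e" using assms(2) by (simp add: weak_unit_def)
  have "sup x 0 - sup (- x) 0 = x"
    using prts[of x] pprt_neg[of x] by (simp add: pprt_def)
  moreover have "(\<lambda>n. ?a n - ?b n) \<longlonglongrightarrow> sup x 0 - sup (- x) 0"
    by (intro tendsto_diff tendsto_inf_weak_unit assms) auto
  ultimately show "(\<lambda>n. ?a n - ?b n) \<longlonglongrightarrow> x" by simp
  fix n
  have ne: "0 \<le> real n *\<^sub>R e" using e0 by (simp add: scaleR_nonneg_nonneg)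
  have "?a n - ?b n \<le> real n *\<^sub>R e - 0" by (rule diff_mono) (use ne in auto)
  moreover have "?b n - ?a n \<le> real n *\<^sub>R e - 0" by (rule diff_mono) (use ne in auto)
  ultimately show "\<bar>?a n - ?b n\<bar> \<le> real n *\<^sub>R e"
    by (intro abs_leI) (simp_all only: minus_diff_eq diff_zero)
qed

section \<open>Powers and Cesaro means of positive operators\<close>

lemma bounded_linear_funpow:
  fixes T :: "'a::real_normed_vector \<Rightarrow> 'a"
  assumes "bounded_linear T"
  shows "bounded_linear (T ^^ n)"
proof (induction n)
  case 0
  then show ?case by (simp add: id_def bounded_linear_ident)
next
  case (Suc n)
  then show ?case using bounded_linear_compose[OF assms] by (simp add: comp_def)
qed

lemma linear_funpow:
  fixes T :: "'a::real_vector \<Rightarrow> 'a"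
  assumes "linear T"
  shows "linear (T ^^ n)"
proof (induction n)
  case 0
  then show ?case by (auto intro!: linearI)
next
  case (Suc n)
  then show ?case using linear_compose[OF _ assms] by (simp add: comp_def)
qed

lemma linear_cesaro:
  assumes "linear T"
  shows "linear (cesaro T n)"
  by (rule linearI)
    (simp_all add: cesaro_def linear_add[OF linear_funpow[OF assms]]
      linear_scale[OF linear_funpow[OF assms]] sum.distrib scaleR_add_right
      scaleR_sum_right[symmetric] mult.commute)

lemma positive_operator_mono:
  assumes "linear T" "positive_operator T" "x \<le> y"
  shows "T x \<le> T y"
proof -
  have "0 \<le> T (y - x)" using assms by (simp add: positive_operator_def)
  then show ?thesis by (simp add: linear_diff[OF assms(1)])
qed

lemma positive_operator_abs:
  assumes "linear T" "positive_operator T" "\<bar>x\<bar> \<le> y"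
  shows "\<bar>T x\<bar> \<le> T y"
proof (rule abs_leI)
  have "x \<le> y" using assms(3) abs_ge_self order_trans by blast
  then show "T x \<le> T y" by (rule positive_operator_mono[OF assms(1,2)])
  have "- x \<le> y" using assms(3) abs_ge_minus_self order_trans by blast
  then have "T (- x) \<le> T y" by (rule positive_operator_mono[OF assms(1,2)])
  then show "- T x \<le> T y" by (simp add: linear_neg[OF assms(1)])
qed

lemma positive_operator_funpow:
  fixes T :: "'a::vector_lattice \<Rightarrow> 'a"
  assumes "positive_operator T"
  shows "positive_operator (T ^^ n)"
  using assms by (induction n) (simp_all add: positive_operator_def)

lemma positive_operator_cesaro:
  assumes "positive_operator T"
  shows "positive_operator (cesaro T n)"
  unfolding positive_operator_def
proof (intro allI impI)
  fix x :: 'a assume "0 \<le> x"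
  then show "0 \<le> cesaro T n x"
    using positive_operator_funpow[OF assms]
    unfolding cesaro_def positive_operator_def
    by (intro scaleR_nonneg_nonneg sum_nonneg) auto
qed

lemma cesaro_coboundary:
  assumes "linear T"
  shows "cesaro T n (y - T y) = (1 / real n) *\<^sub>R (y - (T ^^ n) y)"
proof -
  have "(T ^^ k) (y - T y) = (T ^^ k) y - (T ^^ Suc k) y" for k
    by (simp add: linear_diff[OF linear_funpow[OF assms]] funpow_swap1)
  then show ?thesis
    by (simp add: cesaro_def sum_lessThan_telescope'[where f = "\<lambda>k. (T ^^ k) y"] del: funpow.simps)
qed

lemma cesaro_fixed:
  assumes "T x = x"
  shows "cesaro T (Suc n) x = x"
proof -
  have "(T ^^ k) x = x" for k using assms by (induction k) auto
  then show ?thesis by (simp add: cesaro_def sum_constant_scaleR)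
qed

text \<open>The left side is the average of \<open>x - (T ^^ k) x\<close>, and each of these is the
  image of the partial orbit sum \<open>?s k\<close> under \<open>I - T\<close>. In the limit this
  places \<open>x - P x\<close> in the closure of the range of \<open>I - T\<close>.\<close>

lemma minus_cesaro_coboundary:
  assumes "linear T"
  shows "\<exists>u. x - cesaro T (Suc n) x = u - T u"
proof
  let ?N = "Suc n"
  let ?s = "\<lambda>k. \<Sum>j<k. (T ^^ j) x"
  let ?u = "(1 / real ?N) *\<^sub>R (\<Sum>k<?N. ?s k)"
  have s: "?s k - T (?s k) = x - (T ^^ k) x" for k
    using sum_lessThan_telescope'[of "\<lambda>k. (T ^^ k) x" k]
    by (simp add: linear_sum[OF assms] sum_subtractf)
  have "?u - T ?u = (1 / real ?N) *\<^sub>R (\<Sum>k<?N. ?s k - T (?s k))"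
    by (simp only: linear_scale[OF assms] linear_sum[OF assms] sum_subtractf scaleR_diff_right)
  also have "\<dots> = (1 / real ?N) *\<^sub>R (\<Sum>k<?N. x) - cesaro T ?N x"
    by (simp only: s cesaro_def sum_subtractf scaleR_diff_right)
  also have "(1 / real ?N) *\<^sub>R (\<Sum>k<?N. x) = x"
    by (simp add: sum_constant_scaleR del: sum.lessThan_Suc)
  finally show "x - cesaro T ?N x = ?u - T ?u" by simp
qed

section \<open>The mean ergodic projection and approximation by coboundaries\<close>

text \<open>By telescoping, \<open>I - T\<close> maps the mean of length \<open>n\<close> to
  \<open>(x - (T ^^ n) x) / n\<close>, which tends to 0 in norm since the powers are bounded;
  continuity of \<open>T\<close> carries this to the limit.\<close>

lemma mean_ergodic_projection_fixed:
  assumes T: "bounded_linear T" and pb: "power_bounded T" and me: "mean_ergodic T"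
  shows "T (mean_ergodic_projection T x) = mean_ergodic_projection T x"
proof -
  let ?P = "mean_ergodic_projection T x"
  have lin: "linear T" by (rule bounded_linear.linear[OF T])
  have lim: "(\<lambda>n. cesaro T (Suc n) x) \<longlonglongrightarrow> ?P"
    using me unfolding mean_ergodic_def mean_ergodic_projection_def
    by (simp add: convergent_LIMSEQ_iff)
  obtain C where C: "\<And>n. onorm (T ^^ n) \<le> C"
    using pb unfolding power_bounded_def bdd_above_def by auto
  have Cx: "norm ((T ^^ n) x) \<le> C * norm x" for n
    using onorm[OF bounded_linear_funpow[OF T], of n x] C[of n]
    by (meson mult_right_mono norm_ge_zero order_trans)
  have comm: "T (cesaro T n x) = cesaro T n (T x)" for n
    by (simp add: cesaro_def linear_scale[OF lin] linear_sum[OF lin] funpow_swap1)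
  have "(\<lambda>n. cesaro T (Suc n) x - T (cesaro T (Suc n) x)) \<longlonglongrightarrow> 0"
  proof (rule Lim_null_comparison)
    show "(\<lambda>n. (norm x + C * norm x) * (1 / real (Suc n))) \<longlonglongrightarrow> 0"
      using tendsto_mult[OF tendsto_const LIMSEQ_Suc[OF lim_1_over_n]] by force
    show "\<forall>\<^sub>F n in sequentially. norm (cesaro T (Suc n) x - T (cesaro T (Suc n) x))
        \<le> (norm x + C * norm x) * (1 / real (Suc n))"
    proof (rule always_eventually, rule allI)
      fix n
      have "cesaro T (Suc n) x - T (cesaro T (Suc n) x) = (1 / real (Suc n)) *\<^sub>R (x - (T ^^ Suc n) x)"
        using cesaro_coboundary[OF lin, of "Suc n" x]
        by (simp only: comm linear_diff[OF linear_cesaro[OF lin]])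
      also have "norm \<dots> = norm (x - (T ^^ Suc n) x) * (1 / real (Suc n))"
        by (simp del: funpow.simps)
      also have "\<dots> \<le> (norm x + C * norm x) * (1 / real (Suc n))"
        using norm_triangle_ineq4[of x "(T ^^ Suc n) x"] Cx[of "Suc n"]
        by (intro mult_right_mono) (auto simp del: funpow.simps)
      finally show "norm (cesaro T (Suc n) x - T (cesaro T (Suc n) x))
        \<le> (norm x + C * norm x) * (1 / real (Suc n))" .
    qed
  qed
  moreover have "(\<lambda>n. cesaro T (Suc n) x - T (cesaro T (Suc n) x)) \<longlonglongrightarrow> ?P - T ?P"
    by (intro tendsto_diff lim bounded_linear.tendsto[OF T])
  ultimately have "?P - T ?P = 0" using LIMSEQ_unique by blast
  then show ?thesis by simp
qed

text \<open>One half of \<open>\<epsilon>\<close> pays for replacing \<open>P x\<close> by a Cesaro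
  mean, which makes the difference an exact coboundary \<open>u - T u\<close>; the other half pays
  for moving \<open>u\<close> into the ideal of \<open>e\<close>.\<close>

lemma minus_mean_ergodic_projection_approx:
  fixes e :: "'a::banach_lattice"
  assumes oc: "order_continuous_norm TYPE('a)" and e: "weak_unit e"
    and T: "bounded_linear T" and me: "mean_ergodic T" and "0 < \<epsilon>"
  shows "\<exists>y c. 0 \<le> c \<and> \<bar>y\<bar> \<le> c *\<^sub>R e \<and> norm (x - mean_ergodic_projection T x - (y - T y)) < \<epsilon>"
proof -
  let ?P = "mean_ergodic_projection T x"
  have "(\<lambda>n. cesaro T (Suc n) x) \<longlonglongrightarrow> ?P"
    using me unfolding mean_ergodic_def mean_ergodic_projection_def
    by (simp add: convergent_LIMSEQ_iff)
  then obtain n where n: "norm (cesaro T (Suc n) x - ?P) < \<epsilon> / 2"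
    using LIMSEQ_D[of _ ?P "\<epsilon> / 2"] \<open>0 < \<epsilon>\<close> by (meson half_gt_zero order_refl)
  obtain u where u: "x - cesaro T (Suc n) x = u - T u"
    using minus_cesaro_coboundary[OF bounded_linear.linear[OF T]] by blast
  obtain y where y: "y \<longlonglongrightarrow> u" "\<And>m. \<bar>y m\<bar> \<le> real m *\<^sub>R e"
    by (rule weak_unit_ideal_dense[OF oc e, of u]) blast
  have "(\<lambda>m. y m - T (y m)) \<longlonglongrightarrow> u - T u"
    by (intro tendsto_diff y(1) bounded_linear.tendsto[OF T])
  then obtain m where m: "norm (y m - T (y m) - (u - T u)) < \<epsilon> / 2"
    using LIMSEQ_D[of _ "u - T u" "\<epsilon> / 2"] \<open>0 < \<epsilon>\<close> by (meson half_gt_zero order_refl)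
  have "x - ?P - (y m - T (y m)) = (cesaro T (Suc n) x - ?P) - (y m - T (y m) - (u - T u))"
    unfolding u[symmetric] by (simp add: algebra_simps)
  also have "norm \<dots> < \<epsilon>"
    using norm_triangle_ineq4[of "cesaro T (Suc n) x - ?P" "y m - T (y m) - (u - T u)"] n m
    by linarith
  finally show ?thesis
    using y(2)[of m] of_nat_0_le_iff by blast
qed

text \<open>The weights \<open>2 ^ k\<close> still leave a norm-convergent series, and each of its
  nonnegative terms lies below the sum.\<close>

lemma summable_domination:
  fixes z :: "nat \<Rightarrow> 'a::banach_lattice"
  assumes "\<And>k. norm (z k) \<le> (1 / 4) ^ k"
  shows "\<exists>w\<ge>0. \<forall>k. \<bar>z k\<bar> \<le> (1 / 2) ^ k *\<^sub>R w"
proof -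
  let ?f = "\<lambda>k. 2 ^ k *\<^sub>R \<bar>z k\<bar>"
  have norm_abs: "norm \<bar>x\<bar> \<le> norm x" for x :: 'a
    by (rule lattice_norm) simp
  have "norm (?f k) \<le> (1 / 2) ^ k" for k
  proof -
    have "norm (?f k) \<le> 2 ^ k * (1 / 4) ^ k"
      using order_trans[OF norm_abs assms] by simp
    also have "\<dots> = (1 / 2) ^ k" by (simp flip: power_mult_distrib)
    finally show ?thesis .
  qed
  then have "summable ?f"
    by (intro summable_comparison_test[OF _ summable_geometric[of "1 / 2 :: real"]]) auto
  then have lim: "(\<lambda>n. \<Sum>k<n. ?f k) \<longlonglongrightarrow> suminf ?f" by (rule summable_LIMSEQ)
  have nonneg: "0 \<le> ?f k" for k by (simp add: scaleR_nonneg_nonneg)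
  have le: "?f k \<le> suminf ?f" for k
  proof (rule limit_mono[OF tendsto_const lim])
    have "?f k \<le> (\<Sum>k<n. ?f k)" if "k < n" for n
      using that sum_mono2[of "{..<n}" "{k}" ?f] nonneg by auto
    then show "\<forall>\<^sub>F n in sequentially. ?f k \<le> (\<Sum>k<n. ?f k)"
      by (auto simp: eventually_sequentially intro!: exI[of _ "Suc k"])
  qed
  have "\<bar>z k\<bar> \<le> (1 / 2) ^ k *\<^sub>R suminf ?f" for k
    using scaleR_left_mono[OF le[of k], of "(1 / 2) ^ k"] by (simp flip: power_mult_distrib)
  moreover have "0 \<le> suminf ?f" using le[of 0] nonneg[of 0] order_trans by blast
  ultimately show ?thesis by blast
qed

section \<open>Transfer between the lattice and its universal completion\<close>

lemma universal_completion_le_iff: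
  assumes "universal_completion J"
  shows "J x \<le> J y \<longleftrightarrow> x \<le> y"
  using assms unfolding universal_completion_def by (metis injD le_iff_inf)

lemma universal_completion_abs:
  assumes "universal_completion J"
  shows "J \<bar>x\<bar> = \<bar>J x\<bar>"
  using assms unfolding universal_completion_def by (simp add: abs_lattice linear_neg)

text \<open>Countable suprema of \<open>'a\<close> remain suprema in the completion. Otherwise order
  density puts some \<open>J y > 0\<close> below the gap \<open>J s - inf (J s) w\<close>, and
  \<open>s - y\<close> would be a smaller upper bound.\<close>

lemma universal_completion_sup_le:
  assumes J: "universal_completion J"
    and le: "\<And>n. d n \<le> s" and least: "\<And>z. (\<And>n. d n \<le> z) \<Longrightarrow> s \<le> z"
    and w: "\<And>n. J (d n) \<le> w"
  shows "J s \<le> w"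
proof (rule ccontr)
  assume "\<not> J s \<le> w"
  then have "inf (J s) w \<noteq> J s" by (metis inf.cobounded2)
  then have "inf (J s) w < J s" by (simp add: less_le)
  then have "0 < J s - inf (J s) w" by (simp only: diff_gt_0_iff_gt)
  then obtain y where y: "0 < J y" "J y \<le> J s - inf (J s) w"
    using J unfolding universal_completion_def by blast
  have lin: "linear J" using J by (simp add: universal_completion_def)
  have "d n \<le> s - y" for n
  proof -
    have "J (d n) \<le> inf (J s) w"
      using w le by (simp add: universal_completion_le_iff[OF J])
    also have "\<dots> \<le> J (s - y)"
      using y(2) unfolding linear_diff[OF lin] by (simp only: le_diff_eq add.commute)
    finally show ?thesis by (simp add: universal_completion_le_iff[OF J])
  qed
  then have "s \<le> s - y" by (rule least)
  then have "J y \<le> J 0" by (simp add: universal_completion_le_iff[OF J])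
  with y(1) show False by (simp add: linear_0[OF lin])
qed

lemma uo_convergent_if_order_convergent_completion:
  fixes x :: "nat \<Rightarrow> 'a::banach_lattice"
  assumes oc: "order_continuous_norm TYPE('a)" and J: "universal_completion J"
    and conv: "order_convergent (\<lambda>n. J (x n)) (J l)"
  shows "uo_convergent x l"
  unfolding uo_convergent_def
proof (intro allI impI)
  fix u :: 'a assume u: "0 \<le> u"
  have lin: "linear J" using J by (simp add: universal_completion_def)
  obtain y where y: "seq_decreases_to y 0" and xy: "\<And>n. \<bar>J (x n) - J l\<bar> \<le> y n"
    using conv unfolding order_convergent_def by blast
  define d where "d n = inf \<bar>x n - l\<bar> u" for n
  have Jd: "J (d n) \<le> y n" for n
  proof -
    have "J (d n) \<le> J \<bar>x n - l\<bar>" by (simp add: universal_completion_le_iff[OF J] d_def)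
    also have "\<dots> = \<bar>J (x n) - J l\<bar>" by (simp add: universal_completion_abs[OF J] linear_diff[OF lin])
    finally show ?thesis using xy order_trans by blast
  qed
  \<comment> \<open>The dominating sequence \<open>y\<close> lives in the completion, so one inside
    \<open>'a\<close> is built from tail suprema of \<open>d\<close>, which exist because
    \<open>u\<close> bounds \<open>d\<close>. Regularity gives \<open>J (s n) \<le> y n\<close>,
    which forces \<open>s\<close> down to 0.\<close>
  have "\<exists>s. (\<forall>m. d (n + m) \<le> s) \<and> (\<forall>z. (\<forall>m. d (n + m) \<le> z) \<longrightarrow> s \<le> z)" for n
    by (rule order_continuous_norm_countable_sup[OF oc, of _ u]) (simp add: d_def)
  then obtain s where ub: "\<And>n m. d (n + m) \<le> s n"
    and least: "\<And>n z. (\<And>m. d (n + m) \<le> z) \<Longrightarrow> s n \<le> z"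
    by metis
  have Js: "J (s n) \<le> y n" for n
  proof (rule universal_completion_sup_le[OF J, of "\<lambda>m. d (n + m)"])
    fix m
    have "y (n + m) \<le> y n"
      using y by (auto simp: seq_decreases_to_def intro: decseqD)
    then show "J (d (n + m)) \<le> y n" using Jd order_trans by blast
  qed (use ub least in auto)
  have d0: "0 \<le> d n" for n using u by (simp add: d_def)
  have ds: "d n \<le> s n" for n using ub[of n 0] by simp
  have "seq_decreases_to s 0"
    unfolding seq_decreases_to_def
  proof (intro conjI allI impI)
    show "decseq s"
      by (intro decseq_SucI least) (use ub[of _ "Suc _"] in simp)
    show "0 \<le> s n" for n using d0 ds order_trans by blast
    fix z assume z: "\<forall>n. z \<le> s n"
    have "J z \<le> y n" for n
      using z Js[of n] universal_completion_le_iff[OF J, of z "s n"] by auto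
    then have "J z \<le> J 0" using y by (simp add: seq_decreases_to_def linear_0[OF lin])
    then show "z \<le> 0" by (simp add: universal_completion_le_iff[OF J])
  qed
  then show "order_convergent (\<lambda>n. inf \<bar>x n - l\<bar> u) 0"
    unfolding order_convergent_def using d0 ds by (intro exI[of _ s]) (simp flip: d_def)
qed

section \<open>Order convergence of the Cesaro means\<close>

text \<open>The dominating sequence consists of the tail suprema, which exist by Dedekind
  completeness and \<open>b\<close>. The premise \<open>small\<close> speaks of arbitrary upper
  bounds \<open>t\<close> of tails, so that explicit estimates can be inserted directly.\<close>

lemma order_convergentI_complete:
  fixes f :: "nat \<Rightarrow> 'u::universally_complete_vector_lattice"
  assumes bound: "\<And>n. \<bar>f n - l\<bar> \<le> b"
    and small: "\<And>z. (\<And>n t. (\<And>m. n \<le> m \<Longrightarrow> \<bar>f m - l\<bar> \<le> t) \<Longrightarrow> z \<le> t) \<Longrightarrow> z \<le> 0"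
  shows "order_convergent f l"
proof -
  define y where "y n = Sup ((\<lambda>m. \<bar>f m - l\<bar>) ` {n..})" for n
  have bdd: "bdd_above ((\<lambda>m. \<bar>f m - l\<bar>) ` A)" for A
    by (rule bdd_aboveI[where M = b]) (use bound in blast)
  have le: "\<bar>f m - l\<bar> \<le> y n" if "n \<le> m" for m n
    unfolding y_def using that by (intro cSup_upper[OF _ bdd]) auto
  have "seq_decreases_to y 0"
    unfolding seq_decreases_to_def
  proof (intro conjI allI impI)
    show "decseq y"
      unfolding y_def by (intro decseq_SucI cSup_subset_mono bdd) auto
    show "0 \<le> y n" for n using le[of n n] abs_ge_zero order_trans by blast
    fix z assume z: "\<forall>n. z \<le> y n"
    show "z \<le> 0"
    proof (rule small)
      fix n t assume "\<And>m. n \<le> m \<Longrightarrow> \<bar>f m - l\<bar> \<le> t"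
      then have "y n \<le> t" unfolding y_def by (intro cSup_least) auto
      then show "z \<le> t" using z order_trans by blast
    qed
  qed
  then show ?thesis unfolding order_convergent_def using le by blast
qed

theorem theorem3p7:
  fixes e :: "'a::banach_lattice"
    and T :: "'a \<Rightarrow> 'a"
    and J :: "'a \<Rightarrow> 'u::universally_complete_vector_lattice"
  assumes "order_continuous_norm TYPE('a)"
    and "weak_unit e"
    and "universal_completion J"
    and "bounded_linear T"
    and "positive_operator T"
    and "power_bounded T"
    and "mean_ergodic T"
    and "T e \<le> e"
    and "\<forall>x. order_bounded (range (\<lambda>n. J (cesaro T (Suc n) \<bar>x\<bar>)))"
  shows "\<forall>x. order_convergent (\<lambda>n. J (cesaro T (Suc n) x)) (J (mean_ergodic_projection T x)) \<and>
             uo_convergent (\<lambda>n. cesaro T (Suc n) x) (mean_ergodic_projection T x)"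
proof
  fix x
  let ?A = "\<lambda>n. cesaro T (Suc n)"
  let ?P = "mean_ergodic_projection T x"
  let ?v = "x - ?P"
  have lin: "linear T" by (rule bounded_linear.linear[OF assms(4)])
  have linJ: "linear J" using assms(3) by (simp add: universal_completion_def)
  note J_le = universal_completion_le_iff[OF assms(3)]
  note J_abs = universal_completion_abs[OF assms(3)]
  note linA = linear_cesaro[OF lin]
  note absA = positive_operator_abs[OF linA positive_operator_cesaro[OF assms(5)]]
  have e0: "0 \<le> e" using assms(2) by (simp add: weak_unit_def)
  \<comment> \<open>As \<open>P x\<close> is fixed by \<open>T\<close>, the claim becomes
    convergence of \<open>?A n ?v\<close> to 0.\<close>
  have Av: "?A n ?v = ?A n x - ?P" for n
    using mean_ergodic_projection_fixed[OF assms(4,6,7), of x]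
    by (simp add: linear_diff[OF linA] cesaro_fixed)
  then have JAv: "\<bar>J (?A n x) - J ?P\<bar> = J \<bar>?A n ?v\<bar>" for n
    by (simp add: J_abs linear_diff[OF linJ])
  have bounded: "\<exists>b. \<forall>n. J (?A n \<bar>t\<bar>) \<le> b" for t
    using assms(9) unfolding order_bounded_def by (metis atLeastAtMost_iff rangeI subsetD)
  have Te: "(T ^^ n) e \<le> e" for n
  proof (induction n)
    case (Suc n)
    have "(T ^^ Suc n) e \<le> T e" using positive_operator_mono[OF lin assms(5) Suc] by simp
    then show ?case using assms(8) order_trans by blast
  qed simp
  \<comment> \<open>The rate \<open>(1 / 4) ^ k\<close> is what \<open>summable_domination\<close>
    needs to yield one \<open>w\<close> for all \<open>k\<close>.\<close>
  have "\<forall>k. \<exists>y c. 0 \<le> c \<and> \<bar>y\<bar> \<le> c *\<^sub>R e \<and> norm (?v - (y - T y)) < (1 / 4) ^ k"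
    by (intro allI minus_mean_ergodic_projection_approx assms) simp
  then obtain y c where c0: "\<And>k. 0 \<le> c k" and y: "\<And>k. \<bar>y k\<bar> \<le> c k *\<^sub>R e"
    and small: "\<And>k. norm (?v - (y k - T (y k))) < (1 / 4) ^ k"
    by metis
  define z where "z k = ?v - (y k - T (y k))" for k
  obtain w where w0: "0 \<le> w" and zw: "\<And>k. \<bar>z k\<bar> \<le> (1 / 2) ^ k *\<^sub>R w"
    using summable_domination[of z] small unfolding z_def by (meson less_imp_le)
  obtain b where b: "\<And>n. J (?A n w) \<le> b"
    using bounded[of w] w0 by auto
  have b0: "0 \<le> b"
  proof -
    have "0 \<le> ?A 0 w" using positive_operator_cesaro[OF assms(5)] w0 by (simp add: positive_operator_def)
    then have "J 0 \<le> J (?A 0 w)" by (simp add: J_le)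
    then show ?thesis using b[of 0] by (simp add: linear_0[OF linJ])
  qed
  \<comment> \<open>After telescoping only \<open>y k\<close> and \<open>(T ^^ Suc n) (y k)\<close>
    remain, and \<open>T e \<le> e\<close> keeps both moduli below \<open>c k *\<^sub>R e\<close>;
    hence the factor 2.\<close>
  have coboundary: "\<bar>?A n (y k - T (y k))\<bar> \<le> (1 / real (Suc n)) *\<^sub>R (2 * c k) *\<^sub>R e" for n k
  proof -
    have "\<bar>(T ^^ Suc n) (y k)\<bar> \<le> (T ^^ Suc n) (c k *\<^sub>R e)"
      by (rule positive_operator_abs[OF linear_funpow[OF lin] positive_operator_funpow[OF assms(5)] y])
    also have "\<dots> \<le> c k *\<^sub>R e"
      unfolding linear_scale[OF linear_funpow[OF lin]] by (rule scaleR_left_mono[OF Te c0])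
    finally have "\<bar>y k\<bar> + \<bar>(T ^^ Suc n) (y k)\<bar> \<le> c k *\<^sub>R e + c k *\<^sub>R e"
      using y by (rule add_mono[rotated])
    with abs_triangle_ineq4 have "\<bar>y k - (T ^^ Suc n) (y k)\<bar> \<le> c k *\<^sub>R e + c k *\<^sub>R e"
      by (rule order_trans)
    also have "\<dots> = (2 * c k) *\<^sub>R e" by (simp flip: scaleR_add_left)
    finally have le: "\<bar>y k - (T ^^ Suc n) (y k)\<bar> \<le> (2 * c k) *\<^sub>R e" .
    have scale: "\<bar>r *\<^sub>R t\<bar> \<le> r *\<^sub>R t'" if "0 \<le> r" "\<bar>t\<bar> \<le> t'" for r and t t' :: 'a
    proof (rule abs_leI)
      show "r *\<^sub>R t \<le> r *\<^sub>R t'" using that by (meson scaleR_left_mono abs_ge_self order_trans)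
      have "r *\<^sub>R (- t) \<le> r *\<^sub>R t'" using that by (meson scaleR_left_mono abs_ge_minus_self order_trans)
      then show "- (r *\<^sub>R t) \<le> r *\<^sub>R t'" by simp
    qed
    show ?thesis unfolding cesaro_coboundary[OF lin] by (rule scale[OF _ le]) simp
  qed
  \<comment> \<open>The bound \<open>b\<close> depends on neither \<open>n\<close> nor
    \<open>k\<close>, so the second term is small uniformly in \<open>n\<close>.\<close>
  have main: "J \<bar>?A n ?v\<bar> \<le> (1 / real (Suc n)) *\<^sub>R J ((2 * c k) *\<^sub>R e) + (1 / 2) ^ k *\<^sub>R b" for n k
  proof -
    have "?A n ?v = ?A n (y k - T (y k)) + ?A n (z k)"
      by (simp add: z_def flip: linear_add[OF linA])
    then have "\<bar>?A n ?v\<bar> \<le> \<bar>?A n (y k - T (y k))\<bar> + \<bar>?A n (z k)\<bar>"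
      using abs_triangle_ineq by simp
    also have "\<dots> \<le> (1 / real (Suc n)) *\<^sub>R (2 * c k) *\<^sub>R e + ?A n ((1 / 2) ^ k *\<^sub>R w)"
      by (intro add_mono coboundary absA zw)
    finally have "J \<bar>?A n ?v\<bar> \<le> J ((1 / real (Suc n)) *\<^sub>R (2 * c k) *\<^sub>R e + ?A n ((1 / 2) ^ k *\<^sub>R w))"
      by (simp add: J_le)
    also have "\<dots> = (1 / real (Suc n)) *\<^sub>R J ((2 * c k) *\<^sub>R e) + (1 / 2) ^ k *\<^sub>R J (?A n w)"
      by (simp only: linear_add[OF linJ] linear_scale[OF linJ] linear_scale[OF linA])
    also have "\<dots> \<le> (1 / real (Suc n)) *\<^sub>R J ((2 * c k) *\<^sub>R e) + (1 / 2) ^ k *\<^sub>R b"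
      by (intro add_left_mono scaleR_left_mono b) simp
    finally show ?thesis .
  qed
  have "order_convergent (\<lambda>n. J (?A n x)) (J ?P)"
  proof -
    \<comment> \<open>This separate use of order boundedness, for \<open>\<bar>?v\<bar>\<close>,
      only secures the existence of the tail suprema.\<close>
    obtain b' where b': "\<And>n. J (?A n \<bar>?v\<bar>) \<le> b'" using bounded by blast
    show ?thesis
    proof (rule order_convergentI_complete[where b = b'])
      fix n
      have "J \<bar>?A n ?v\<bar> \<le> J (?A n \<bar>?v\<bar>)" by (simp add: J_le absA)
      then show "\<bar>J (?A n x) - J ?P\<bar> \<le> b'" unfolding JAv using b' order_trans by blast
    next
      fix s assume s: "\<And>n t. (\<And>m. n \<le> m \<Longrightarrow> \<bar>J (?A m x) - J ?P\<bar> \<le> t) \<Longrightarrow> s \<le> t"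
      have ek: "0 \<le> J ((2 * c k) *\<^sub>R e)" for k
        using J_le[of 0 "(2 * c k) *\<^sub>R e"] c0[of k] e0
        by (simp add: linear_0[OF linJ] scaleR_nonneg_nonneg)
      \<comment> \<open>The estimate at \<open>n\<close> bounds the whole tail, since the
        coefficient \<open>1 / real (Suc m)\<close> decreases in \<open>m\<close>.\<close>
      have "s \<le> (1 / real (Suc n)) *\<^sub>R J ((2 * c k) *\<^sub>R e) + (1 / 2) ^ k *\<^sub>R b" for n k
      proof (rule s[of n], unfold JAv)
        fix m assume "n \<le> m"
        then have "(1 / real (Suc m)) *\<^sub>R J ((2 * c k) *\<^sub>R e) \<le> (1 / real (Suc n)) *\<^sub>R J ((2 * c k) *\<^sub>R e)"
          by (intro scaleR_right_mono ek) (simp add: frac_le)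
        then show "J \<bar>?A m ?v\<bar> \<le> (1 / real (Suc n)) *\<^sub>R J ((2 * c k) *\<^sub>R e) + (1 / 2) ^ k *\<^sub>R b"
          using main[of m k] by (meson add_right_mono order_trans)
      qed
      \<comment> \<open>First \<open>n \<rightarrow> \<infinity>\<close> with \<open>k\<close>
        fixed, since \<open>c k\<close> may grow with \<open>k\<close>; afterwards
        \<open>k \<rightarrow> \<infinity>\<close>.\<close>
      then have "s - (1 / 2) ^ k *\<^sub>R b \<le> (1 / real (Suc n)) *\<^sub>R J ((2 * c k) *\<^sub>R e)" for n k
        by (simp only: diff_le_eq)
      then have "s - (1 / 2) ^ k *\<^sub>R b \<le> 0" for k
        by (rule archimedean_complete_vanishing[OF _ LIMSEQ_Suc[OF lim_1_over_n] _ ek]) simp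
      then have "s \<le> (1 / 2) ^ k *\<^sub>R b" for k by simp
      then show "s \<le> 0"
        by (rule archimedean_complete_vanishing[OF _ LIMSEQ_power_zero _ b0]) auto
    qed
  qed
  then show "order_convergent (\<lambda>n. J (?A n x)) (J ?P) \<and> uo_convergent (\<lambda>n. ?A n x) ?P"
    by (intro conjI uo_convergent_if_order_convergent_completion[OF assms(1,3)])
qed

end
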